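(* Let $A=(A,\tau)$ be a finite quasilinear cycle set with $|A|>1$. Then $\operatorname{Soc}(A)\neq 0$, i.e. there is an element $b\in A$, $b\neq 0$, such that $\tau(a+b)=\tau(a)+\tau(b)$ for all $a\in A$.
   Context: A cycle set is a set $X$ with a binary operation $\ast$ such that for every $x\in X$ the map $\sigma_x:X\to X$, $y\mapsto x\ast y$, is bijective, and $(x\ast y)\ast(x\ast z)=(y\ast x)\ast(y\ast z)$ for all $x,y,z\in X$, and the diagonal map $x\mapsto x\ast x$ is bijective (for finite $X$ this last condition is automatic). A quasilinear cycle set is a pair $(A,\tau)$, where $A$ is an abelian group (written additively) and $\tau:A\to A$ is a bijection with $\tau(0)=0$, such that $A$ is a cycle set under the operation $a\ast b=\tau(b-a)-\tau(-a)$. The socle of a quasilinear cycle set $(A,\tau)$ is $\operatorname{Soc}(A)=\{b\in A:\ \tau(a+b)=\tau(a)+\tau(b)\text{ for all }a\in A\}$. *)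

theory Defs
  imports Main
begin

text \<open>Since \<open>bij_betw (op x) X X\<close> includes \<open>op x ` X = X\<close>, the set \<open>X\<close> is closed under the
  operation.\<close>

definition cycle_set :: "'a set \<Rightarrow> ('a \<Rightarrow> 'a \<Rightarrow> 'a) \<Rightarrow> bool" where
  "cycle_set X op \<longleftrightarrow>
     (\<forall>x\<in>X. bij_betw (op x) X X) \<and>
     (\<forall>x\<in>X. \<forall>y\<in>X. \<forall>z\<in>X. op (op x y) (op x z) = op (op y x) (op y z)) \<and>
     bij_betw (\<lambda>x. op x x) X X"

definition ql_op :: "('a::ab_group_add \<Rightarrow> 'a) \<Rightarrow> 'a \<Rightarrow> 'a \<Rightarrow> 'a" where
  "ql_op \<tau> a b = \<tau> (b - a) - \<tau> (- a)"

definition quasilinear_cycle_set :: "('a::ab_group_add \<Rightarrow> 'a) \<Rightarrow> bool" where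
  "quasilinear_cycle_set \<tau> \<longleftrightarrow> bij \<tau> \<and> \<tau> 0 = 0 \<and> cycle_set UNIV (ql_op \<tau>)"

definition socle :: "('a::ab_group_add \<Rightarrow> 'a) \<Rightarrow> 'a set" where
  "socle \<tau> = {b. \<forall>a. \<tau> (a + b) = \<tau> a + \<tau> b}"

end

theory Submission
  imports Defs "HOL-Algebra.Sylow" "HOL-Algebra.Multiplicative_Group"
begin

text \<open>
  Write \<open>\<Delta>\<^sub>d h x = h (x + d) - h d\<close>. The left translations \<open>\<sigma>\<^sub>x = \<Delta>\<^sub>-\<^sub>x \<tau>\<close> of the cycle set generate a
  permutation group \<open>H\<close> fixing \<open>0\<close>, and \<open>x \<mapsto> \<sigma>\<^sub>x\<close> extends to finite multisets \<open>m\<close> of points. The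
  relation \<open>\<sigma>\<^sub>m = \<sigma>\<^sub>n\<close> is a congruence, which makes \<open>H\<close> an abelian group of exponent
  \<open>e = ord \<tau>\<close> (a brace), on which \<open>A\<close> acts additively by the \<open>\<Delta>\<^sub>d\<close>. For a factor \<open>Q\<close> of \<open>e\<close>
  let \<open>H\<^sub>Q\<close> be the subgroup of the \<open>Q\<close>-th multiples and \<open>K\<^sub>Q\<close> the kernel of the action of \<open>A\<close> on
  \<open>H\<^sub>Q\<close>; these kernels are invariant under \<open>H\<close>, and \<open>K\<^sub>1\<close> is the socle.

  Splitting prime powers off \<open>e\<close> one at a time, it suffices that a nonzero invariant subgroup \<open>M\<close>
  meets \<open>K\<^sub>Q\<close> when \<open>e = q\<^sup>k Q\<close> with \<open>q\<close> prime. Then \<open>H\<^sub>Q\<close> is a \<open>q\<close>-group. If \<open>q\<close> divides \<open>|M|\<close>, it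
  has a nonzero fixed point in \<open>M\<close>, which lies in \<open>K\<^sub>Q\<close>. Otherwise let \<open>W\<close> be the elements of \<open>H\<^sub>Q\<close>
  killed by \<open>\<Sum>\<^sub>b\<^sub>\<in>\<^sub>M \<Delta>\<^sub>b\<close>. By coprimality only the identity of \<open>W\<close> is \<open>M\<close>-invariant, so in the
  permutation group \<open>M W\<close> the subgroup of translations by \<open>M\<close> is self-normalizing, and a
  Frobenius count shows that \<open>W\<close> is trivial. As \<open>h - \<Delta>\<^sub>b h \<in> W\<close>, this gives \<open>M \<subseteq> K\<^sub>Q\<close>.
\<close>

text \<open>What remains of \<open>h\<close> when it is moved past a translation:
  \<open>h \<circ> translate d = translate (h d) \<circ> \<Delta> d h\<close>.\<close>

definition \<Delta> :: "'a::ab_group_add \<Rightarrow> ('a \<Rightarrow> 'a) \<Rightarrow> 'a \<Rightarrow> 'a" where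
  "\<Delta> d h = (\<lambda>x. h (x + d) - h d)"

definition translate :: "'a::ab_group_add \<Rightarrow> 'a \<Rightarrow> 'a" where
  "translate b = (\<lambda>x. x + b)"

definition subgrp :: "'a::ab_group_add set \<Rightarrow> bool" where
  "subgrp M \<longleftrightarrow> 0 \<in> M \<and> (\<forall>a\<in>M. \<forall>b\<in>M. a + b \<in> M) \<and> (\<forall>a\<in>M. - a \<in> M)"

definition perm_group :: "('a \<Rightarrow> 'a) set \<Rightarrow> bool" where
  "perm_group H \<longleftrightarrow> id \<in> H \<and> (\<forall>g\<in>H. \<forall>h\<in>H. g \<circ> h \<in> H) \<and> (\<forall>h\<in>H. bij h)"

text \<open>For a permutation group \<open>H\<close> and a subgroup \<open>M\<close> mapped to
  itself by \<open>H\<close>, this makes the products of translations by \<open>M\<close> with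
  elements of \<open>H\<close> a group, in which \<open>H\<close> is the stabilizer of 0.\<close>

definition \<Delta>_closed :: "('a::ab_group_add \<Rightarrow> 'a) set \<Rightarrow> bool" where
  "\<Delta>_closed H \<longleftrightarrow> (\<forall>h\<in>H. h 0 = 0 \<and> (\<forall>d. \<Delta> d h \<in> H))"

section \<open>Permutations of finite order and translations\<close>

lemma funpow_coprime_id:
  fixes f :: "'a \<Rightarrow> 'a"
  assumes "f ^^ a = id" "f ^^ b = id" "coprime a b"
  shows "f = id"
proof (cases "a = 0")
  case True
  then show ?thesis using assms by simp
next
  case False
  obtain x y where xy: "a * x = b * y + 1"
    using bezout_nat[OF False, of b] assms(3) by (auto simp: coprime_iff_gcd_eq_1)
  have *: "f ^^ (n * k) = id" if "f ^^ n = id" for n k :: nat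
    using that funpow_mult[where m = n and n = k and f = f] by simp
  have "f ^^ (b * y + 1) = id"
    using *[OF assms(1), of x] xy by simp
  then show ?thesis
    using *[OF assms(2), of y] by (simp add: funpow_add)
qed

lemma bij_funpow_eq_id:
  fixes f :: "'a::finite \<Rightarrow> 'a"
  assumes "bij f"
  obtains r where "r > 0" "f ^^ r = id"
proof -
  have "\<not> inj (\<lambda>n. f ^^ n)"
    using finite_imageD[of "\<lambda>n. f ^^ n" UNIV] finite[of "range (\<lambda>n. f ^^ n)"] infinite_UNIV_nat
    by blast
  then obtain i j where ij: "i < j" "f ^^ i = f ^^ j"
    unfolding inj_def by (metis linorder_neqE_nat)
  have "f ^^ (i + (j - i)) = f ^^ i"
    using ij by simp
  then have "(f ^^ i) \<circ> (f ^^ (j - i)) = (f ^^ i) \<circ> id"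
    by (simp add: funpow_add)
  then have "(f ^^ i) ((f ^^ (j - i)) x) = (f ^^ i) x" for x
    by (simp add: fun_eq_iff)
  then have "f ^^ (j - i) = id"
    using injD[OF inj_fn[OF bij_is_inj[OF assms]]] by fastforce
  then show thesis
    using that[of "j - i"] ij by simp
qed

lemma perm_group_funpow:
  assumes "perm_group H" "h \<in> H"
  shows "h ^^ n \<in> H"
  using assms by (induction n) (auto simp: perm_group_def)

text \<open>Some positive power of \<open>h\<close> is the identity, so the inverse is itself a
  power of \<open>h\<close>.\<close>

lemma perm_group_inv:
  fixes H :: "('a::finite \<Rightarrow> 'a) set"
  assumes H: "perm_group H" and h: "h \<in> H"
  shows "inv_into UNIV h \<in> H"
proof -
  have b: "bij h"
    using H h by (simp add: perm_group_def)
  then obtain r where r: "r > 0" "h ^^ r = id"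
    using bij_funpow_eq_id by blast
  have "h \<circ> (h ^^ (r - 1)) = id"
    using r by (metis Suc_diff_1 funpow.simps(2))
  then have "inv_into UNIV h = h ^^ (r - 1)"
    by (metis b bij_is_inj fun.map_comp inv_o_cancel comp_id id_comp)
  then show ?thesis
    using perm_group_funpow[OF H h] by simp
qed

lemma translate_funpow: "(translate z ^^ n) x = x + (translate z ^^ n) 0"
  by (induction n) (auto simp: translate_def algebra_simps)

lemma translate_funpow_sum: "(translate z ^^ n) 0 = (\<Sum>i<n. z)"
  by (induction n) (auto simp: translate_def algebra_simps)

text \<open>Translation by \<open>z\<close> permutes \<open>M\<close> and so preserves the sum of
  its elements; hence \<open>card M\<close> copies of \<open>z\<close> add up to 0.\<close>

lemma translate_funpow_card:
  fixes M :: "'a::{ab_group_add,finite} set"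
  assumes M: "subgrp M" and z: "z \<in> M"
  shows "translate z ^^ card M = id"
proof -
  have "bij_betw (\<lambda>b. b + z) M M"
    by (rule bij_betwI[where g = "\<lambda>b. b + - z"]) (use M z in \<open>auto simp: subgrp_def simp del: add_uminus_conv_diff\<close>)
  then have "(\<Sum>b\<in>M. b) = (\<Sum>b\<in>M. b + z)"
    using sum.reindex_bij_betw[of "\<lambda>b. b + z" M M id] by simp
  then have "(\<Sum>b\<in>M. z) = 0"
    by (simp add: sum.distrib)
  moreover obtain f where "bij_betw f {..<card M} M"
    using ex_bij_betw_nat_finite[of M] by (auto simp: lessThan_atLeast0)
  then have "(\<Sum>b\<in>M. z) = (\<Sum>i<card M. z)"
    using sum.reindex_bij_betw[of f "{..<card M}" M "\<lambda>_. z"] by simp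
  ultimately show ?thesis
    by (intro ext) (metis translate_funpow translate_funpow_sum add.right_neutral id_apply)
qed

section \<open>Fixed points and a Frobenius count\<close>

text \<open>\<open>\<Delta> x h\<close> also belongs to \<open>H\<close>, and that it fixes
  \<open>b\<close> is the claim rearranged.\<close>

lemma additive_left_if_fixes:
  assumes "\<Delta>_closed H" and fixb: "\<And>h. h \<in> H \<Longrightarrow> h b = b" and "h \<in> H"
  shows "h (x + b) = h x + b"
proof -
  have "\<Delta> x h \<in> H"
    using assms by (simp add: \<Delta>_closed_def)
  then have "\<Delta> x h b = b"
    by (rule fixb)
  then show ?thesis
    by (simp add: \<Delta>_def algebra_simps)
qed

lemma \<Delta>_eq_if_fixes:
  assumes "\<Delta>_closed H" and "\<And>h. h \<in> H \<Longrightarrow> h b = b" and "h \<in> H"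
  shows "\<Delta> b h = h"
proof -
  have "h (x + b) - h b = h x" for x
    using additive_left_if_fixes[of H b h x] assms by (metis add_diff_cancel_right')
  then show ?thesis
    by (simp add: \<Delta>_def)
qed

text \<open>
  Induction on \<open>H\<close>. By the induction hypothesis, every translation by an element of \<open>M\<close> outside
  the fixed points \<open>Z\<close> of \<open>H\<close> has trivial centralizer in \<open>H\<close>. Hence the conjugates of the
  translations by \<open>M - Z\<close> are pairwise distinct and leave out, as in a Frobenius group, exactly
  \<open>Z H\<close>, so \<open>Z H\<close> is normalized by \<open>M\<close>; since \<open>|H|\<close> is prime to \<open>|M|\<close>, so is \<open>H\<close>.
\<close>

lemma \<Delta>_closed_coprime_trivial:
  fixes H :: "('a::{ab_group_add,finite} \<Rightarrow> 'a) set"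
  assumes "perm_group H" "\<Delta>_closed H" "subgrp M"
    and "\<And>h b. h \<in> H \<Longrightarrow> b \<in> M \<Longrightarrow> h b \<in> M"
    and "\<And>h. h \<in> H \<Longrightarrow> h ^^ N = id"
    and "coprime N (card M)"
    and "\<And>h. h \<in> H \<Longrightarrow> (\<And>b. b \<in> M \<Longrightarrow> \<Delta> b h = h) \<Longrightarrow> h = id"
  shows "H = {id}"
  using assms
proof (induction "card H" arbitrary: H rule: less_induct)
  case less
  note grp = less.prems(1) and Dcl = less.prems(2) and M = less.prems(3) and HM = less.prems(4)
    and exponent = less.prems(5) and cop = less.prems(6) and triv = less.prems(7)
  have fin: "finite S" for S :: "('a \<Rightarrow> 'a) set" by simp
  have id: "id \<in> H" and comp: "\<And>g h. g \<in> H \<Longrightarrow> h \<in> H \<Longrightarrow> g \<circ> h \<in> H"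
    and bij: "\<And>h. h \<in> H \<Longrightarrow> bij h"
    using grp by (auto simp: perm_group_def)
  have zero: "\<And>h. h \<in> H \<Longrightarrow> h 0 = 0" and D: "\<And>h d. h \<in> H \<Longrightarrow> \<Delta> d h \<in> H"
    using Dcl by (auto simp: \<Delta>_closed_def)
  have inv: "inv_into UNIV h \<in> H" if "h \<in> H" for h
    using perm_group_inv grp that by blast
  have inv1: "inv_into UNIV h (h x) = x" and inv2: "h (inv_into UNIV h x) = x" if "h \<in> H" for h x
    using bij[OF that] by (auto simp: bij_is_inj bij_is_surj surj_f_inv_f)
  define Z where "Z = {a \<in> M. \<forall>h\<in>H. h a = a}"
  have Z_add: "h (x + z) = h x + z" if "h \<in> H" "z \<in> Z" for h x z
    using additive_left_if_fixes[OF Dcl, of z h x] that by (auto simp: Z_def)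
  \<comment> \<open>\<open>kd\<close> says that \<open>k\<close> conjugates the translation by
    \<open>d\<close> to the one by \<open>k d\<close>; this will give the injectivity behind
    \<open>card_U\<close>.\<close>
  have stab: "k = id" if k: "k \<in> H" and d: "d \<in> M - Z" and kd: "\<And>x. k (x + d) = k x + k d" for k d
  proof -
    define c where "c = k d"
    have "c \<in> M"
      using HM k d by (auto simp: c_def)
    have "c \<notin> Z"
    proof
      assume cZ: "c \<in> Z"
      then have "k c = k d"
        using k by (auto simp: Z_def c_def)
      then have "c = d"
        by (metis inv1[OF k])
      with cZ d show False by simp
    qed
    \<comment> \<open>The centralizer of the translation by \<open>c\<close>. It is proper because
      \<open>c\<close> is not fixed by all of \<open>H\<close>, so the induction hypothesis
      applies.\<close>
    define C where "C = {h \<in> H. \<forall>x. h (x + c) = h x + c}"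
    have "C \<noteq> H"
    proof
      assume "C = H"
      then have "h c = c" if "h \<in> H" for h
      proof -
        have "h (0 + c) = h 0 + c"
          using that \<open>C = H\<close> unfolding C_def by blast
        then show ?thesis
          using zero[OF that] by simp
      qed
      then show False
        using \<open>c \<in> M\<close> \<open>c \<notin> Z\<close> by (auto simp: Z_def)
    qed
    then have card: "card C < card H"
      by (intro psubset_card_mono) (auto simp: C_def)
    have "perm_group C"
      using grp by (auto simp: perm_group_def C_def)
    moreover have "\<Delta>_closed C"
    proof -
      have "\<Delta> d h (x + c) = \<Delta> d h x + c" if "h \<in> C" for h d x
      proof -
        have "h (x + c + d) = h (x + d + c)"
          by (simp add: algebra_simps)
        also have "\<dots> = h (x + d) + c"
          using that by (simp add: C_def)
        finally show ?thesis
          by (simp add: \<Delta>_def)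
      qed
      then show ?thesis
        using zero D by (auto simp: \<Delta>_closed_def C_def)
    qed
    ultimately have C: "C = {id}"
      using less.hyps[OF card] M HM exponent cop triv by (auto simp: C_def)
    show ?thesis
    proof (rule triv[OF k])
      fix a assume a: "a \<in> M"
      \<comment> \<open>Both \<open>k\<close> and \<open>\<Delta> a k\<close> turn translation by
        \<open>d\<close> into translation by \<open>c\<close>, so \<open>g\<close> centralizes the
        latter and is the identity.\<close>
      define g where "g = \<Delta> a k \<circ> inv_into UNIV k"
      have g: "g \<in> H"
        using comp D inv k by (auto simp: g_def)
      have "g (x + c) = g x + c" for x
      proof -
        define y where "y = inv_into UNIV k x"
        have x: "x = k y"
          using inv2[OF k] by (simp add: y_def)
        have "x + c = k (y + d)"
          by (simp add: x c_def kd)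
        then have "g (x + c) = k (y + d + a) - k a"
          by (simp add: g_def \<Delta>_def inv1[OF k])
        also have "\<dots> = k (y + a + d) - k a"
          by (simp add: algebra_simps)
        also have "\<dots> = g x + c"
          by (simp add: kd g_def \<Delta>_def y_def[symmetric] c_def)
        finally show ?thesis .
      qed
      then have "g = id"
        using g C by (auto simp: C_def)
      then have "\<Delta> a k (inv_into UNIV k (k x)) = k x" for x
        by (metis g_def comp_apply id_apply)
      then show "\<Delta> a k = k"
        by (auto simp: inv1[OF k])
    qed
  qed
  \<comment> \<open>The product \<open>M H\<close>, its subset \<open>Z H\<close>, and the
    conjugates of translations by \<open>M - Z\<close>. The last two turn out to be disjoint subsets
    of \<open>\<Gamma>\<close> whose sizes add up to that of \<open>\<Gamma>\<close>.\<close>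
  define \<Gamma> where "\<Gamma> = (\<lambda>(a, h). translate a \<circ> h) ` (M \<times> H)"
  define V where "V = (\<lambda>(a, h). translate a \<circ> h) ` (Z \<times> H)"
  define U where "U = (\<lambda>(d, h). h \<circ> translate d \<circ> inv_into UNIV h) ` ((M - Z) \<times> H)"
  have inj_trans: "inj_on (\<lambda>(a, h). translate a \<circ> h) (M \<times> H)"
  proof (rule inj_onI, clarify)
    fix a g b h assume "g \<in> H" "h \<in> H" and eq: "translate a \<circ> g = translate b \<circ> h"
    have "(translate a \<circ> g) 0 = (translate b \<circ> h) 0"
      by (simp add: eq)
    then have "a = b"
      using zero[OF \<open>g \<in> H\<close>] zero[OF \<open>h \<in> H\<close>] by (simp add: translate_def)
    moreover have "g x = h x" for x
      using fun_cong[OF eq, of x] \<open>a = b\<close> by (simp add: translate_def)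
    ultimately show "a = b \<and> g = h"
      by auto
  qed
  have Z_sub: "Z \<subseteq> M"
    by (auto simp: Z_def)
  have card_\<Gamma>: "card \<Gamma> = card M * card H"
    using inj_trans by (simp add: \<Gamma>_def card_image card_cartesian_product)
  have card_V: "card V = card Z * card H"
  proof -
    have "Z \<times> H \<subseteq> M \<times> H"
      using Z_sub by auto
    then have "card V = card (Z \<times> H)"
      unfolding V_def by (intro card_image inj_on_subset[OF inj_trans])
    then show ?thesis
      by (simp add: card_cartesian_product)
  qed
  have inj_U: "inj_on (\<lambda>(d, h). h \<circ> translate d \<circ> inv_into UNIV h) ((M - Z) \<times> H)"
  proof (rule inj_onI, clarify)
    fix d h d' h'
    assume d: "d \<in> M" "d \<notin> Z" and h: "h \<in> H" "h' \<in> H"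
      and eq: "h \<circ> translate d \<circ> inv_into UNIV h = h' \<circ> translate d' \<circ> inv_into UNIV h'"
    define k where "k = inv_into UNIV h' \<circ> h"
    have k: "k \<in> H"
      using h comp inv by (auto simp: k_def)
    have kd: "k (x + d) = k x + d'" for x
    proof -
      have "h (x + d) = h' (inv_into UNIV h' (h x) + d')"
        using fun_cong[OF eq, of "h x"] by (simp add: translate_def inv1[OF h(1)])
      then show ?thesis
        by (simp add: k_def inv1[OF h(2)])
    qed
    have "k d = d'"
      using kd[of 0] zero[OF k] by simp
    then have "k = id"
      using stab[OF k, of d] d kd by simp
    then have "d = d'"
      using \<open>k d = d'\<close> by simp
    moreover have "h x = h' x" for x
      using inv2[OF h(2), of "h x"] \<open>k = id\<close> by (metis k_def comp_apply id_apply)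
    ultimately show "d = d' \<and> h = h'"
      by auto
  qed
  have card_U: "card U = card (M - Z) * card H"
    using inj_U by (simp add: U_def card_image card_cartesian_product)
  have "V \<subseteq> \<Gamma>"
    using Z_sub by (auto simp: V_def \<Gamma>_def)
  moreover have "U \<subseteq> \<Gamma>"
  proof
    fix u assume "u \<in> U"
    then obtain d h where d: "d \<in> M" and h: "h \<in> H" and u: "u = h \<circ> translate d \<circ> inv_into UNIV h"
      by (auto simp: U_def)
    have "u = translate (h d) \<circ> (\<Delta> d h \<circ> inv_into UNIV h)"
      by (auto simp: u translate_def \<Delta>_def)
    moreover have "h d \<in> M" "\<Delta> d h \<circ> inv_into UNIV h \<in> H"
      using d h HM comp D inv by auto
    ultimately show "u \<in> \<Gamma>"
      by (auto simp: \<Gamma>_def)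
  qed
  moreover have "U \<inter> V = {}"
  proof (rule ccontr)
    assume "U \<inter> V \<noteq> {}"
    then obtain d k z h where d: "d \<in> M - Z" and k: "k \<in> H" and z: "z \<in> Z" and h: "h \<in> H"
      and eq: "k \<circ> translate d \<circ> inv_into UNIV k = translate z \<circ> h"
      by (auto simp: U_def V_def)
    have "k d = z"
      using fun_cong[OF eq, of 0] inv1[OF k, of 0] by (simp add: translate_def zero[OF k] zero[OF h])
    moreover have "k z = z"
      using z k by (auto simp: Z_def)
    ultimately have "d = z"
      by (metis inv1[OF k])
    with d z show False by simp
  qed
  moreover have "card U + card V = card \<Gamma>"
    using card_mono[OF _ Z_sub] Z_sub
    by (simp add: card_U card_V card_\<Gamma> card_Diff_subset add_mult_distrib[symmetric])
  ultimately have \<Gamma>: "\<Gamma> = U \<union> V"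
    by (metis card_Un_disjoint card_subset_eq fin Un_subset_iff)
  have fixes_M: "h b = b" if h: "h \<in> H" and "b \<in> M" for h b
  proof -
    define c where "c = - b"
    have c: "c \<in> M"
      using M \<open>b \<in> M\<close> by (simp add: c_def subgrp_def)
    \<comment> \<open>A conjugate of \<open>h\<close> that fixes \<open>c\<close>. Members of
      \<open>U\<close> are conjugates of nonzero translations and have no fixed point, so
      \<open>g\<close> must lie in \<open>V\<close>.\<close>
    define g where "g = translate c \<circ> h \<circ> translate b"
    have "g = translate (c + h b) \<circ> \<Delta> b h"
      by (auto simp: g_def translate_def \<Delta>_def)
    moreover have "c + h b \<in> M"
      using M c HM[OF h \<open>b \<in> M\<close>] by (simp add: subgrp_def)
    ultimately have "g \<in> \<Gamma>"
      using D[OF h] by (auto simp: \<Gamma>_def)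
    moreover have "g \<notin> U"
    proof
      assume "g \<in> U"
      then obtain d k where d: "d \<in> M - Z" and k: "k \<in> H"
        and gk: "g = k \<circ> translate d \<circ> inv_into UNIV k"
        by (auto simp: U_def)
      have "g c = c"
        by (simp add: g_def translate_def c_def zero[OF h])
      then have "k (inv_into UNIV k c + d) = k (inv_into UNIV k c)"
        by (simp add: gk translate_def inv2[OF k])
      then have "inv_into UNIV k c + d = inv_into UNIV k c"
        by (metis inv1[OF k])
      then have "d = 0" by simp
      then show False
        using d M zero by (auto simp: Z_def subgrp_def)
    qed
    ultimately have "g \<in> V"
      using \<Gamma> by auto
    then obtain z h' where z: "z \<in> Z" and h': "h' \<in> H" and gz: "g = translate z \<circ> h'"
      by (auto simp: V_def)
    have "(g ^^ n) (x + c) = (h ^^ n) x + c" for n x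
      by (induction n) (auto simp: g_def translate_def c_def)
    then have "(g ^^ N) (x - c + c) = x - c + c" for x
      by (metis exponent[OF h] id_apply)
    then have "(g ^^ N) 0 = 0"
      by (metis diff_add_cancel)
    \<comment> \<open>\<open>h'\<close> fixes all multiples of \<open>z\<close>, so on the orbit of
      0 the map \<open>g\<close> acts as translation by \<open>z\<close>. Hence \<open>N\<close>
      copies of \<open>z\<close> add up to 0, and coprimality forces \<open>z\<close> to be
      0.\<close>
    moreover have "(g ^^ n) 0 = (translate z ^^ n) 0" for n
    proof -
      have "h' ((translate z ^^ n) 0) = (translate z ^^ n) 0" for n
        by (induction n) (auto simp: zero[OF h'] translate_def Z_add[OF h' z])
      then show ?thesis
        by (induction n) (auto simp: gz)
    qed
    ultimately have "translate z ^^ N = id"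
      by (intro ext) (metis translate_funpow add.right_neutral id_apply)
    then have "translate z = id"
      using funpow_coprime_id translate_funpow_card[OF M, of z] cop z Z_sub by blast
    then have "g 0 = 0"
      using zero[OF h'] by (simp add: gz)
    then show ?thesis
      by (simp add: g_def translate_def c_def)
  qed
  have "h = id" if "h \<in> H" for h
  proof (rule triv[OF that])
    fix b assume "b \<in> M"
    show "\<Delta> b h = h"
      by (rule \<Delta>_eq_if_fixes[OF Dcl _ that]) (use fixes_M \<open>b \<in> M\<close> in blast)
  qed
  then show ?case
    using id by auto
qed

section \<open>Lagrange's theorem and orbit counting\<close>

lemma perm_group_funpow_card:
  fixes H :: "('a::finite \<Rightarrow> 'a) set"
  assumes H: "perm_group H" and h: "h \<in> H"
  shows "h ^^ card H = id"
proof -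
  define G :: "('a \<Rightarrow> 'a) monoid" where "G = \<lparr>carrier = H, monoid.mult = (\<circ>), one = id\<rparr>"
  have "group G"
  proof (rule groupI)
    fix g assume "g \<in> carrier G"
    then have "g \<in> H" "inj g"
      using H by (auto simp: G_def perm_group_def bij_is_inj)
    then show "\<exists>g'\<in>carrier G. g' \<otimes>\<^bsub>G\<^esub> g = \<one>\<^bsub>G\<^esub>"
      using perm_group_inv[OF H] by (intro bexI[of _ "inv_into UNIV g"]) (auto simp: G_def)
  qed (use H in \<open>auto simp: G_def perm_group_def\<close>)
  then interpret group G .
  have "h [^]\<^bsub>G\<^esub> n = h ^^ n" for n :: nat
    by (induction n) (auto simp: G_def funpow_swap1 nat_pow_def fun_eq_iff)
  moreover have "h [^]\<^bsub>G\<^esub> order G = \<one>\<^bsub>G\<^esub>"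
    using pow_order_eq_1 h by (simp add: G_def)
  ultimately show ?thesis
    by (simp add: order_def G_def)
qed

text \<open>The fibres of evaluation at \<open>x\<close> are the left cosets of the stabilizer of
  \<open>x\<close>, hence equal in size.\<close>

lemma card_orbit_dvd:
  fixes H :: "('a::finite \<Rightarrow> 'a) set"
  assumes H: "perm_group H"
  shows "card ((\<lambda>h. h x) ` H) dvd card H"
proof -
  define F where "F = (\<lambda>y. {h \<in> H. h x = y})"
  have card_F: "card (F y) = card (F x)" if y: "y \<in> (\<lambda>h. h x) ` H" for y
  proof -
    obtain g where g: "g \<in> H" "y = g x"
      using y by auto
    have "bij g"
      using H g by (simp add: perm_group_def)
    then have g_inv: "inv_into UNIV g \<circ> g = id" "g \<circ> inv_into UNIV g = id"
      by (auto simp: bij_is_inj bij_is_surj surj_f_inv_f)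
    have "bij_betw (\<lambda>h. g \<circ> h) (F x) (F y)"
    proof (rule bij_betwI[where g = "\<lambda>h. inv_into UNIV g \<circ> h"])
      show "(\<lambda>h. g \<circ> h) \<in> F x \<rightarrow> F y"
        using H g by (auto simp: F_def perm_group_def)
      show "(\<lambda>h. inv_into UNIV g \<circ> h) \<in> F y \<rightarrow> F x"
        using H g perm_group_inv[OF H g(1)] \<open>bij g\<close>
        by (auto simp: F_def perm_group_def bij_is_inj)
    qed (use g_inv in \<open>simp_all add: o_assoc\<close>)
    then show ?thesis
      using bij_betw_same_card by fastforce
  qed
  have "card H = (\<Sum>y\<in>(\<lambda>h. h x) ` H. card (F y))"
    using sum.image_gen[of H "\<lambda>_. 1::nat" "\<lambda>h. h x"] by (simp add: F_def)
  also have "\<dots> = card ((\<lambda>h. h x) ` H) * card (F x)"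
    using card_F by simp
  finally show ?thesis by simp
qed

text \<open>Every orbit in \<open>S\<close> has as its size a power of \<open>q\<close> other than
  1; orbits are removed one at a time.\<close>

lemma prime_dvd_card_no_fixpoint:
  fixes H :: "('a::finite \<Rightarrow> 'a) set" and q :: nat
  assumes H: "perm_group H" "card H = q ^ j" and q: "prime q"
    and "\<And>h x. h \<in> H \<Longrightarrow> x \<in> S \<Longrightarrow> h x \<in> S"
    and "\<And>x. x \<in> S \<Longrightarrow> \<exists>h\<in>H. h x \<noteq> x"
  shows "q dvd card S"
  using assms(4,5)
proof (induction "card S" arbitrary: S rule: less_induct)
  case less
  show ?case
  proof (cases "S = {}")
    case True
    then show ?thesis by simp
  next
    case False
    then obtain x where x: "x \<in> S" by auto
    define B where "B = (\<lambda>h. h x) ` H"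
    have "id \<in> H"
      using H by (simp add: perm_group_def)
    then have xB: "x \<in> B"
      unfolding B_def by (rule rev_image_eqI) simp
    have BS: "B \<subseteq> S"
      using less.prems(1) x by (auto simp: B_def)
    have "card B \<noteq> 1"
    proof
      assume "card B = 1"
      then have "B = {x}"
        using xB by (auto simp: card_1_singleton_iff)
      then show False
        using less.prems(2)[OF x] by (auto simp: B_def)
    qed
    moreover obtain i where "card B = q ^ i"
      using card_orbit_dvd[OF H(1), of x] H(2) q divides_primepow_nat by (auto simp: B_def)
    ultimately have "q dvd card B"
      by (cases i) auto
    moreover have "q dvd card (S - B)"
    proof (rule less.hyps)
      show "card (S - B) < card S"
        using x xB by (intro psubset_card_mono) auto
      fix y assume y: "y \<in> S - B"
      show "\<exists>h\<in>H. h y \<noteq> y"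
        using less.prems(2) y by simp
      fix h assume h: "h \<in> H"
      have "h y \<notin> B"
      proof
        assume "h y \<in> B"
        then obtain g where g: "g \<in> H" "h y = g x"
          by (auto simp: B_def)
        have "y = inv_into UNIV h (g x)"
          using H(1) h g(2) by (metis perm_group_def bij_is_inj inv_f_f)
        then have "y = (inv_into UNIV h \<circ> g) x"
          by simp
        moreover have "inv_into UNIV h \<circ> g \<in> H"
          using H(1) g(1) perm_group_inv[OF H(1) h] by (simp add: perm_group_def)
        ultimately have "y \<in> B"
          unfolding B_def by (rule rev_image_eqI[rotated])
        then show False
          using y by simp
      qed
      then show "h y \<in> S - B"
        using less.prems(1) h y by simp
    qed
    moreover have "card S = card B + card (S - B)"
      using BS by (metis card_Un_disjoint Diff_disjoint Diff_partition finite)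
    ultimately show ?thesis by simp
  qed
qed

section \<open>Left translations extended to multisets\<close>

locale quasilinear =
  fixes \<tau> :: "'a::{ab_group_add,finite} \<Rightarrow> 'a"
  assumes ql: "quasilinear_cycle_set \<tau>"
begin

definition step :: "'a \<Rightarrow> ('a \<Rightarrow> 'a) \<Rightarrow> 'a \<Rightarrow> 'a" where
  "step x g = ql_op \<tau> (g x) \<circ> g"

definition \<sigma> :: "'a multiset \<Rightarrow> 'a \<Rightarrow> 'a" where
  "\<sigma> m = fold_mset step id m"

definition eqv :: "'a multiset \<Rightarrow> 'a multiset \<Rightarrow> bool" (infix "\<approx>" 50) where
  "m \<approx> n \<longleftrightarrow> \<sigma> m = \<sigma> n"

lemma \<tau>_0: "\<tau> 0 = 0"
  and bij_op: "bij (ql_op \<tau> a)"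
  and op_cycle: "ql_op \<tau> (ql_op \<tau> x y) (ql_op \<tau> x z) = ql_op \<tau> (ql_op \<tau> y x) (ql_op \<tau> y z)"
  using ql by (auto simp: quasilinear_cycle_set_def cycle_set_def)

text \<open>The cycle set equation, read at \<open>g x\<close> and \<open>g y\<close>, says that two
  steps commute, so the fold over a multiset is independent of the order.\<close>

sublocale comp_fun_commute step
proof
  fix x y
  have "step y (step x g) z = step x (step y g) z" for g z
    by (simp add: step_def op_cycle[of "g x" "g y"])
  then show "step y \<circ> step x = step x \<circ> step y"
    by (intro ext) simp
qed

lemma \<sigma>_empty: "\<sigma> {#} = id"
  by (simp add: \<sigma>_def)

lemma \<sigma>_single: "\<sigma> {#x#} = ql_op \<tau> x"
  by (simp add: \<sigma>_def step_def)

lemma \<sigma>_add_mset: "\<sigma> (add_mset x m) = ql_op \<tau> (\<sigma> m x) \<circ> \<sigma> m"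
  by (simp add: \<sigma>_def step_def)

text \<open>The brace relation between addition, which is union of multisets, and
  composition.\<close>

lemma \<sigma>_union: "\<sigma> (m + n) = \<sigma> (image_mset (\<sigma> m) n) \<circ> \<sigma> m"
  by (induction n) (auto simp: \<sigma>_empty \<sigma>_add_mset)

lemma bij_\<sigma>: "bij (\<sigma> m)"
  by (induction m) (simp_all only: \<sigma>_empty \<sigma>_add_mset bij_op bij_comp bij_id)

lemma \<sigma>_0: "\<sigma> m 0 = 0"
  by (induction m) (auto simp: \<sigma>_empty \<sigma>_add_mset ql_op_def)

text \<open>Up to a term in \<open>a\<close> alone, which \<open>\<Delta>\<close> cancels,
  \<open>ql_op \<tau> a b\<close> depends only on \<open>b - a\<close>; so recentring at
  \<open>d\<close> shifts every point by \<open>- d\<close>.\<close>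

lemma \<Delta>_\<sigma>: "\<Delta> d (\<sigma> m) = \<sigma> (image_mset (\<lambda>x. x - d) m)"
proof (induction m)
  case empty
  then show ?case by (auto simp: \<sigma>_empty \<Delta>_def)
next
  case (add x m)
  define g where "g = \<sigma> (image_mset (\<lambda>x. x - d) m)"
  have g: "g y = \<sigma> m (y + d) - \<sigma> m d" for y
    by (simp add: g_def add[symmetric] \<Delta>_def)
  have "\<sigma> (image_mset (\<lambda>x. x - d) (add_mset x m)) y = ql_op \<tau> (g (x - d)) (g y)" for y
    by (simp add: \<sigma>_add_mset g_def)
  then show ?case
    by (intro ext) (simp add: g \<Delta>_def \<sigma>_add_mset ql_op_def)
qed

section \<open>The congruence and its additive group\<close>

lemma eqv_refl: "m \<approx> m" and eqv_sym: "m \<approx> n \<Longrightarrow> n \<approx> m"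
  and eqv_trans [trans]: "m \<approx> n \<Longrightarrow> n \<approx> k \<Longrightarrow> m \<approx> k"
  by (simp_all add: eqv_def)

lemma eqv_add: "m \<approx> m' \<Longrightarrow> n \<approx> n' \<Longrightarrow> m + n \<approx> m' + n'"
proof -
  have *: "m + k \<approx> n + k" if "m \<approx> n" for m n k
    using that by (simp add: eqv_def \<sigma>_def)
  assume "m \<approx> m'" "n \<approx> n'"
  then show ?thesis
    using *[of m m' n] *[of n n' m'] by (auto simp: add.commute eqv_def)
qed

text \<open>Composed with \<open>\<sigma> k\<close>, the two sides become
  \<open>\<sigma> (k + m)\<close> and \<open>\<sigma> (k + n)\<close>, which agree; the bijection
  \<open>\<sigma> k\<close> cancels.\<close>

lemma eqv_image:
  assumes "m \<approx> n"
  shows "image_mset (\<sigma> k) m \<approx> image_mset (\<sigma> k) n"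
proof -
  have "\<sigma> (image_mset (\<sigma> k) m) \<circ> \<sigma> k = \<sigma> (image_mset (\<sigma> k) n) \<circ> \<sigma> k"
    using eqv_add[OF eqv_refl assms, of k] by (simp add: \<sigma>_union eqv_def)
  then have "\<sigma> (image_mset (\<sigma> k) m) (\<sigma> k x) = \<sigma> (image_mset (\<sigma> k) n) (\<sigma> k x)" for x
    by (simp add: fun_eq_iff)
  then show ?thesis
    unfolding eqv_def using surjD[OF bij_is_surj[OF bij_\<sigma>[of k]]] by (intro ext) metis
qed

lemma eqv_shift:
  assumes "m \<approx> n"
  shows "image_mset (\<lambda>x. x + d) m \<approx> image_mset (\<lambda>x. x + d) n"
  using assms \<Delta>_\<sigma>[of "- d" m] \<Delta>_\<sigma>[of "- d" n] by (simp add: eqv_def)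

lemma eqv_repeat: "m \<approx> n \<Longrightarrow> repeat_mset k m \<approx> repeat_mset k n"
  by (induction k) (auto simp: eqv_refl intro: eqv_add)

lemma repeat_image_mset: "repeat_mset k (image_mset f m) = image_mset f (repeat_mset k m)"
  by (induction k) auto

definition exponent :: nat where
  "exponent = (SOME e. e > 0 \<and> \<tau> ^^ e = id)"

lemma exponent_pos: "exponent > 0" and \<tau>_exponent: "\<tau> ^^ exponent = id"
proof -
  have "bij \<tau>"
    using ql by (simp add: quasilinear_cycle_set_def)
  then have "\<exists>e. e > 0 \<and> \<tau> ^^ e = id"
    using bij_funpow_eq_id by metis
  from someI_ex[OF this] show "exponent > 0" "\<tau> ^^ exponent = id"
    by (simp_all add: exponent_def)
qed

text \<open>Left translation by 0 is \<open>\<tau>\<close>, so \<open>n\<close> copies of 0 give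
  \<open>\<tau> ^^ n\<close>. Shifting carries the relation from 0 to any \<open>x\<close>, and
  addition to any multiset.\<close>

lemma repeat_exponent: "repeat_mset exponent m \<approx> {#}"
proof (induction m)
  case empty
  then show ?case by (simp add: eqv_refl)
next
  case (add x m)
  have "\<sigma> (replicate_mset n 0) = \<tau> ^^ n" for n
    by (induction n) (auto simp: \<sigma>_empty \<sigma>_add_mset \<sigma>_0 ql_op_def \<tau>_0 fun_eq_iff)
  then have "replicate_mset exponent 0 \<approx> {#}"
    by (simp add: eqv_def \<tau>_exponent \<sigma>_empty)
  from eqv_shift[OF this, of x] have "replicate_mset exponent x \<approx> {#}"
    by simp
  from eqv_add[OF this add] show ?case
    by simp
qed

text \<open>\<open>exponent - 1\<close> copies of \<open>k\<close> form an additive inverse of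
  \<open>k\<close>.\<close>

lemma eqv_cancel:
  assumes "m + k \<approx> n + k"
  shows "m \<approx> n"
proof -
  define k' where "k' = repeat_mset (exponent - 1) k"
  have "k + k' = repeat_mset exponent k"
    using exponent_pos by (cases exponent) (auto simp: k'_def)
  then have k: "k + k' \<approx> {#}"
    by (simp add: repeat_exponent)
  have "m \<approx> m + (k + k')"
    using eqv_add[OF eqv_refl eqv_sym[OF k]] by simp
  also have "m + (k + k') \<approx> n + (k + k')"
    using eqv_add[OF assms eqv_refl, of k'] by (simp add: add.assoc)
  also have "n + (k + k') \<approx> n"
    using eqv_add[OF eqv_refl k] by simp
  finally show ?thesis .
qed

lemma repeat_coprime_eqv:
  assumes "repeat_mset a m \<approx> {#}" "repeat_mset b m \<approx> {#}" "coprime a b"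
  shows "m \<approx> {#}"
proof (cases "a = 0")
  case True
  then show ?thesis using assms by simp
next
  case False
  obtain x y where xy: "a * x = b * y + 1"
    using bezout_nat[OF False, of b] assms(3) by (auto simp: coprime_iff_gcd_eq_1)
  have "repeat_mset (a * x) m \<approx> {#}" "repeat_mset (b * y) m \<approx> {#}"
    using eqv_repeat[OF assms(1), of x] eqv_repeat[OF assms(2), of y] by (simp_all add: mult.commute)
  then have "m + repeat_mset (b * y) m \<approx> {#}"
    unfolding xy by simp
  moreover have "m + repeat_mset (b * y) m \<approx> m"
    using eqv_add[OF eqv_refl \<open>repeat_mset (b * y) m \<approx> {#}\<close>, of m] by simp
  ultimately show ?thesis
    by (metis eqv_trans eqv_sym)
qed

section \<open>Kernels of the shift action on multiples\<close>

text \<open>By \<open>eqv_shift\<close> the condition at 0 yields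
  \<open>replicate_mset N (x + b) \<approx> replicate_mset N x\<close> for every \<open>x\<close>,
  so this is the kernel of the action on \<open>N\<close>-th multiples.\<close>

definition K :: "nat \<Rightarrow> 'a set" where
  "K N = {b. replicate_mset N b \<approx> replicate_mset N 0}"

definition invariant :: "'a set \<Rightarrow> bool" where
  "invariant M \<longleftrightarrow> subgrp M \<and> (\<forall>m. \<forall>b\<in>M. \<sigma> m b \<in> M)"

lemma invariant_K: "invariant (K N)"
proof -
  have "a + b \<in> K N" if "a \<in> K N" "b \<in> K N" for a b
    using that eqv_shift[of "replicate_mset N a" "replicate_mset N 0" b] by (auto simp: K_def eqv_def)
  moreover have "- a \<in> K N" if "a \<in> K N" for a
    using that eqv_shift[of "replicate_mset N a" "replicate_mset N 0" "- a"] by (auto simp: K_def eqv_def)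
  moreover have "\<sigma> m b \<in> K N" if "b \<in> K N" for m b
    using that eqv_image[of "replicate_mset N b" "replicate_mset N 0" m] by (auto simp: K_def \<sigma>_0)
  ultimately show ?thesis
    by (auto simp: invariant_def subgrp_def K_def eqv_refl)
qed

text \<open>Bezout: from the relation for \<open>a * x\<close> copies, cancel the one for
  \<open>c * y\<close> copies.\<close>

lemma K_gcd:
  assumes "b \<in> K a" "b \<in> K c" "a \<noteq> 0"
  shows "b \<in> K (gcd a c)"
proof -
  obtain x y where xy: "a * x = c * y + gcd a c"
    using bezout_nat[OF assms(3), of c] by blast
  define r where "r = (\<lambda>n x::'a. repeat_mset n {#x#})"
  have K_r: "b \<in> K n \<longleftrightarrow> r n b \<approx> r n 0" for n
    by (simp add: K_def r_def)
  have r_mult: "r (n * k) x = repeat_mset k (r n x)" for n k x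
    by (simp only: r_def repeat_mset_right mult.commute)
  have r_add: "r (n + k) x = r k x + r n x" for n k x
    by (simp only: r_def repeat_mset_distrib add.commute)
  have mult: "b \<in> K (n * k)" if "b \<in> K n" for n k
    using that eqv_repeat[of "r n b" "r n 0" k] by (simp only: K_r r_mult)
  have "r (gcd a c) b + r (c * y) b \<approx> r (gcd a c) 0 + r (c * y) 0"
    using mult[OF assms(1), of x] unfolding xy K_r r_add .
  also have "r (gcd a c) 0 + r (c * y) 0 \<approx> r (gcd a c) 0 + r (c * y) b"
    using eqv_add[OF eqv_refl eqv_sym] mult[OF assms(2), of y] unfolding K_r by blast
  finally show ?thesis
    unfolding K_r by (rule eqv_cancel)
qed

text \<open>The sign arises because left translation by \<open>b\<close> shifts its argument by
  \<open>- b\<close>.\<close>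

lemma K_1_socle: "b \<in> K 1 \<Longrightarrow> - b \<in> socle \<tau>"
proof -
  assume "b \<in> K 1"
  then have "ql_op \<tau> b a = ql_op \<tau> 0 a" for a
    by (simp add: K_def eqv_def \<sigma>_single)
  then have "\<tau> (a - b) - \<tau> (- b) = \<tau> a" for a
    by (simp add: ql_op_def \<tau>_0)
  then have "\<tau> (a - b) = \<tau> a + \<tau> (- b)" for a
    by (metis diff_add_cancel)
  then show ?thesis
    by (simp add: socle_def)
qed


section \<open>The groups of multiples\<close>

text \<open>Multiples for the addition of multisets, as opposed to powers under composition.\<close>

definition powers :: "nat \<Rightarrow> ('a \<Rightarrow> 'a) set" where
  "powers Q = range (\<lambda>m. \<sigma> (repeat_mset Q m))"

lemma \<sigma>_comp: "\<sigma> n \<circ> \<sigma> m = \<sigma> (m + image_mset (inv_into UNIV (\<sigma> m)) n)"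
proof -
  have "image_mset (\<sigma> m \<circ> inv_into UNIV (\<sigma> m)) n = n"
    by (simp add: surj_iff[THEN iffD1, OF bij_is_surj[OF bij_\<sigma>]])
  then show ?thesis
    by (simp add: \<sigma>_union multiset.map_comp)
qed

lemma perm_group_powers: "perm_group (powers Q)"
proof -
  have "id \<in> powers Q"
    unfolding powers_def by (rule range_eqI[of _ _ "{#}"]) (simp add: \<sigma>_empty)
  moreover have "g \<circ> h \<in> powers Q" if gh: "g \<in> powers Q" "h \<in> powers Q" for g h
  proof -
    obtain m n where "g = \<sigma> (repeat_mset Q m)" "h = \<sigma> (repeat_mset Q n)"
      using gh by (auto simp: powers_def)
    then have "g \<circ> h = \<sigma> (repeat_mset Q (n + image_mset (inv_into UNIV h) m))"
      by (simp only: \<sigma>_comp repeat_mset_distrib2 repeat_image_mset)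
    then show ?thesis
      unfolding powers_def by blast
  qed
  ultimately show ?thesis
    by (auto simp: perm_group_def powers_def bij_\<sigma>)
qed

lemma \<Delta>_closed_powers: "\<Delta>_closed (powers Q)"
  by (auto simp: \<Delta>_closed_def powers_def \<sigma>_0 \<Delta>_\<sigma> simp flip: repeat_image_mset)

lemma inv_\<sigma>: "\<exists>k. inv_into UNIV (\<sigma> m) = \<sigma> k"
  using perm_group_inv[OF perm_group_powers[of 1], of "\<sigma> m"] by (auto simp: powers_def)

text \<open>Under addition \<open>powers Q\<close> is an abelian group killed by
  \<open>q ^ k\<close>. Another prime dividing its order would give a nonzero element killed by two
  coprime numbers.\<close>

lemma card_powers:
  fixes q :: nat
  assumes q: "prime q" and tors: "\<And>m. repeat_mset (q ^ k * Q) m \<approx> {#}"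
  shows "\<exists>j. card (powers Q) = q ^ j"
proof -
  \<comment> \<open>Addition of permutations goes through chosen representatives;
    \<open>eqv_add\<close> makes the result independent of the choice.\<close>
  define rep where "rep = (\<lambda>g. SOME m. g = \<sigma> (repeat_mset Q m))"
  define G :: "('a \<Rightarrow> 'a) monoid" where "G = \<lparr>carrier = powers Q,
    monoid.mult = (\<lambda>g h. \<sigma> (repeat_mset Q (rep g + rep h))), one = id\<rparr>"
  define c where "c = (\<lambda>m. \<sigma> (repeat_mset Q m))"
  have rep: "repeat_mset Q (rep (c m)) \<approx> repeat_mset Q m" for m
    unfolding eqv_def c_def rep_def by (rule someI_ex[THEN sym]) blast
  have mult: "c m \<otimes>\<^bsub>G\<^esub> c n = c (m + n)" for m n
    using eqv_add[OF rep[of m] rep[of n]] by (simp add: G_def eqv_def c_def)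
  have one: "\<one>\<^bsub>G\<^esub> = c {#}"
    by (simp add: G_def c_def \<sigma>_empty)
  have carrier: "carrier G = range c"
    by (simp add: G_def powers_def c_def)
  have torsion: "c (repeat_mset (q ^ k) m) = c {#}" for m
    using tors[of m] by (simp add: c_def eqv_def mult.commute)
  have "group G"
  proof (rule groupI)
    fix g assume "g \<in> carrier G"
    then obtain m where m: "g = c m"
      by (auto simp: carrier)
    have "repeat_mset (q ^ k - 1) m + m = repeat_mset (q ^ k) m"
      using q by (metis Suc_diff_1 add.commute prime_gt_0_nat repeat_mset_Suc zero_less_power)
    then show "\<exists>g'\<in>carrier G. g' \<otimes>\<^bsub>G\<^esub> g = \<one>\<^bsub>G\<^esub>"
      by (intro bexI[of _ "c (repeat_mset (q ^ k - 1) m)"])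
        (auto simp: m mult one torsion carrier)
  qed (auto simp: carrier mult one add.assoc)
  then interpret group G .
  have fin: "finite (carrier G)"
    by (simp add: carrier)
  have pow: "c m [^]\<^bsub>G\<^esub> n = c (repeat_mset n m)" for m and n :: nat
    by (induction n) (simp_all add: one mult add.commute)
  have "r = q" if r: "prime r" "r dvd card (powers Q)" for r :: nat
  proof (rule ccontr)
    assume "r \<noteq> q"
    obtain s where "card (powers Q) = r * s"
      using r by auto
    then have "order G = r ^ 1 * s"
      by (simp add: order_def G_def)
    \<comment> \<open>Sylow's theorem with exponent 1 takes the place of Cauchy's.\<close>
    from sylow_thm[OF r(1) \<open>group G\<close> this fin] obtain S where S: "subgroup S G" "card S = r"
      by auto
    then have "\<not> S \<subseteq> {\<one>\<^bsub>G\<^esub>}"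
      using prime_gt_1_nat[OF r(1)] card_mono[of "{\<one>\<^bsub>G\<^esub>}" S] by auto
    then obtain x where x: "x \<in> S" "x \<noteq> \<one>\<^bsub>G\<^esub>"
      by auto
    then obtain m where m: "x = c m"
      using S(1) subgroup.subset carrier by blast
    interpret S: group "G\<lparr>carrier := S\<rparr>"
      using S(1) by (rule subgroup_imp_group)
    have "x [^]\<^bsub>G\<lparr>carrier := S\<rparr>\<^esub> r = \<one>\<^bsub>G\<^esub>"
      using S.pow_order_eq_1[of x] x S(2) by (simp add: order_def)
    then have "c (repeat_mset r m) = c {#}"
      using nat_pow_consistent[of x r S] by (simp add: m pow one)
    then have "repeat_mset r (repeat_mset Q m) \<approx> {#}"
      by (simp add: c_def eqv_def mult.commute)
    moreover have "repeat_mset (q ^ k) (repeat_mset Q m) \<approx> {#}"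
      using tors by simp
    moreover have "coprime r (q ^ k)"
      using r(1) q \<open>r \<noteq> q\<close> by (simp add: primes_coprime)
    ultimately have "repeat_mset Q m \<approx> {#}"
      by (rule repeat_coprime_eqv)
    with x m one show False
      by (simp add: c_def eqv_def)
  qed
  moreover have "card (powers Q) \<noteq> 0"
    using carrier fin by (auto simp: G_def)
  moreover obtain y where y: "card (powers Q) = q ^ multiplicity q (card (powers Q)) * y" "\<not> q dvd y"
    by (rule multiplicity_decompose'[of "card (powers Q)" q]) (use calculation(2) q prime_gt_1_nat[of q] in auto)
  ultimately have "y = 1"
    by (metis dvd_mult prime_factor_nat)
  with y show ?thesis by auto
qed

section \<open>Sums over cosets of an invariant subgroup\<close>

text \<open>Modulo \<open>\<approx>\<close>, this is the operator \<open>\<Sum>\<^sub>b\<^sub>\<in>\<^sub>M \<Delta>\<^sub>-\<^sub>b\<close> on the additive group \<open>H\<close>.\<close>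

definition coset_sum :: "'a set \<Rightarrow> 'a multiset \<Rightarrow> 'a multiset" where
  "coset_sum M m = (\<Sum>b\<in>M. image_mset (\<lambda>x. x + b) m)"

lemma coset_sum_empty: "coset_sum M {#} = {#}"
  by (simp add: coset_sum_def)

lemma coset_sum_union: "coset_sum M (m + n) = coset_sum M m + coset_sum M n"
  by (simp add: coset_sum_def sum.distrib)

lemma coset_sum_repeat: "coset_sum M (repeat_mset k m) = repeat_mset k (coset_sum M m)"
  by (induction k) (auto simp: coset_sum_empty coset_sum_union)

text \<open>For fixed \<open>x\<close> the map sending \<open>b\<close> to
  \<open>g (x + b) - g x\<close> permutes \<open>M\<close>, so \<open>g\<close> carries cosets of
  \<open>M\<close> onto cosets.\<close>

lemma coset_sum_image:
  assumes "inj g" and gM: "\<And>x b. b \<in> M \<Longrightarrow> g (x + b) - g x \<in> M"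
  shows "coset_sum M (image_mset g m) = image_mset g (coset_sum M m)"
proof (induction m)
  case empty
  then show ?case by (simp add: coset_sum_empty)
next
  case (add x m)
  have single: "coset_sum M {#y#} = (\<Sum>b\<in>M. {#y + b#})" for y
    by (simp add: coset_sum_def)
  have "inj_on (\<lambda>b. g (x + b) - g x) M"
    proof (rule inj_onI)
    fix b b' assume "g (x + b) - g x = g (x + b') - g x"
    then have "g (x + b) = g (x + b')" by simp
    then show "b = b'"
      using injD[OF \<open>inj g\<close>] by fastforce
  qed
  moreover have "(\<lambda>b. g (x + b) - g x) ` M \<subseteq> M"
    using gM by auto
  ultimately have "bij_betw (\<lambda>b. g (x + b) - g x) M M"
    by (simp add: bij_betw_def endo_inj_surj)
  then have "(\<Sum>b\<in>M. {#g x + b#}) = (\<Sum>b\<in>M. {#g x + (g (x + b) - g x)#})"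
    using sum.reindex_bij_betw[of "\<lambda>b. g (x + b) - g x" M M "\<lambda>b. {#g x + b#}"] by simp
  also have "\<dots> = (\<Sum>b\<in>M. image_mset g {#x + b#})"
    by simp
  also have "\<dots> = image_mset g (\<Sum>b\<in>M. {#x + b#})"
    using sum_comp_morphism[of "image_mset g" "\<lambda>b. {#x + b#}" M] by (simp add: comp_def)
  finally have "coset_sum M {#g x#} = image_mset g (coset_sum M {#x#})"
    by (simp add: single)
  then show ?case
    using add coset_sum_union[of M "{#x#}" m] coset_sum_union[of M "{#g x#}" "image_mset g m"]
    by simp
qed

lemma sum_eqv_const:
  assumes "finite M" "\<And>b. b \<in> M \<Longrightarrow> f b \<approx> c"
  shows "(\<Sum>b\<in>M. f b) \<approx> repeat_mset (card M) c"
  using assms by (induction M) (auto simp: eqv_refl intro: eqv_add)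

lemma invariant_meets_K:
  fixes q :: nat
  assumes M: "invariant M" "c \<in> M" "c \<noteq> 0" and q: "prime q"
    and tors: "\<And>m. repeat_mset (q ^ k * Q) m \<approx> {#}"
  shows "\<exists>b\<in>M. b \<noteq> 0 \<and> b \<in> K Q"
proof -
  obtain j where j: "card (powers Q) = q ^ j"
    using card_powers[OF q tors] by blast
  have sub: "subgrp M" and inv: "\<And>m b. b \<in> M \<Longrightarrow> \<sigma> m b \<in> M"
    using M by (auto simp: invariant_def)
  have coset: "\<sigma> m (x + b) - \<sigma> m x \<in> M" if "b \<in> M" for m x b
  proof -
    have "\<Delta> x (\<sigma> m) b \<in> M"
      using inv that by (simp add: \<Delta>_\<sigma>)
    then show ?thesis
      by (simp add: \<Delta>_def add.commute)
  qed
  have powers_M: "h b \<in> M" if "h \<in> powers Q" "b \<in> M" for h b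
    using that inv by (auto simp: powers_def)
  show ?thesis
  proof (cases "q dvd card M")
    case True
    \<comment> \<open>If 0 were the only fixed point in \<open>M\<close>, then \<open>q\<close>
      would divide both \<open>card M\<close> and \<open>card M - 1\<close>.\<close>
    have "\<exists>b\<in>M - {0}. \<forall>h\<in>powers Q. h b = b"
    proof (rule ccontr)
      assume nofix: "\<not> ?thesis"
      have "q dvd card (M - {0})"
      proof (rule prime_dvd_card_no_fixpoint[OF perm_group_powers j q])
        fix h x assume h: "h \<in> powers Q" and x: "x \<in> M - {0}"
        have "h 0 = 0" "bij h"
          using h by (auto simp: powers_def \<sigma>_0 bij_\<sigma>)
        then have "h x \<noteq> 0"
          using x by (metis DiffD2 bij_is_inj injD singletonI)
        then show "h x \<in> M - {0}"
          using powers_M h x by simp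
      next
        fix x assume "x \<in> M - {0}"
        then show "\<exists>h\<in>powers Q. h x \<noteq> x"
          using nofix by auto
      qed
      moreover have "card M = Suc (card (M - {0}))"
        using sub by (metis card_Suc_Diff1 finite subgrp_def)
      ultimately have "q dvd 1"
        using True by (metis dvd_add_right_iff Suc_eq_plus1)
      then show False
        using q by simp
    qed
    then obtain b where b: "b \<in> M" "b \<noteq> 0" and fixb: "\<And>h. h \<in> powers Q \<Longrightarrow> h b = b"
      by auto
    \<comment> \<open>\<open>\<Delta> b\<close> acts trivially on \<open>powers Q\<close>, yet it
      shifts \<open>Q\<close> copies of \<open>b\<close> to \<open>Q\<close> copies of 0.\<close>
    have "\<sigma> (repeat_mset Q {#b#}) \<in> powers Q"
      unfolding powers_def by blast
    then have "\<Delta> b (\<sigma> (repeat_mset Q {#b#})) = \<sigma> (repeat_mset Q {#b#})"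
      using \<Delta>_eq_if_fixes[of "powers Q" b, OF \<Delta>_closed_powers] fixb by blast
    then have "replicate_mset Q 0 \<approx> replicate_mset Q b"
      by (simp add: \<Delta>_\<sigma> eqv_def)
    then show ?thesis
      using b by (auto simp: K_def eqv_def)
  next
    case False
    define W where "W = {\<sigma> (repeat_mset Q m) |m. coset_sum M (repeat_mset Q m) \<approx> {#}}"
    have W_sub: "W \<subseteq> powers Q"
      by (auto simp: W_def powers_def)
    have "W = {id}"
    proof (rule \<Delta>_closed_coprime_trivial[OF _ _ sub])
      have "id \<in> W"
        by (auto simp: W_def \<sigma>_empty coset_sum_empty eqv_refl intro!: exI[of _ "{#}"])
      moreover have "g \<circ> h \<in> W" if gh: "g \<in> W" "h \<in> W" for g h
      proof -
        obtain m n where g: "g = \<sigma> (repeat_mset Q m)" "coset_sum M (repeat_mset Q m) \<approx> {#}"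
          and h: "h = \<sigma> (repeat_mset Q n)" "coset_sum M (repeat_mset Q n) \<approx> {#}"
          using gh by (auto simp: W_def)
        obtain l where l: "inv_into UNIV h = \<sigma> l"
          using inv_\<sigma> h by blast
        have "g \<circ> h = \<sigma> (repeat_mset Q (n + image_mset (\<sigma> l) m))"
          unfolding g h \<sigma>_comp l[symmetric] by (simp add: repeat_image_mset)
        moreover have "coset_sum M (image_mset (\<sigma> l) (repeat_mset Q m)) \<approx> {#}"
          using eqv_image[OF g(2), of l] coset_sum_image[OF bij_is_inj[OF bij_\<sigma>] coset]
          by simp
        then have "coset_sum M (repeat_mset Q (n + image_mset (\<sigma> l) m)) \<approx> {#}"
          using eqv_add[OF h(2)] by (simp add: coset_sum_union repeat_image_mset)
        ultimately show ?thesis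
          unfolding W_def by blast
      qed
      ultimately show "perm_group W"
        using W_sub perm_group_powers by (auto simp: perm_group_def)
      have "\<Delta> d h \<in> W" if h: "h \<in> W" for d h
      proof -
        obtain m where m: "h = \<sigma> (repeat_mset Q m)" "coset_sum M (repeat_mset Q m) \<approx> {#}"
          using h by (auto simp: W_def)
        have "coset_sum M (image_mset (\<lambda>x. x + - d) (repeat_mset Q m)) \<approx> {#}"
          using eqv_shift[OF m(2), of "- d"]
          by (subst coset_sum_image) (auto simp: inj_def)
        then show ?thesis
          by (auto simp: W_def m(1) \<Delta>_\<sigma> repeat_image_mset intro!: exI[of _ "image_mset (\<lambda>x. x - d) m"])
      qed
      then show "\<Delta>_closed W"
        using W_sub \<Delta>_closed_powers by (auto simp: \<Delta>_closed_def)
      show "h b \<in> M" if "h \<in> W" "b \<in> M" for h b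
        using that W_sub powers_M by auto
      show "h ^^ (q ^ j) = id" if "h \<in> W" for h
        using that W_sub perm_group_funpow_card[OF perm_group_powers, of h Q] j by auto
      show "coprime (q ^ j) (card M)"
        using False q by (simp add: prime_imp_coprime)
      fix h assume "h \<in> W" and hD: "\<And>b. b \<in> M \<Longrightarrow> \<Delta> b h = h"
      then obtain m where m: "h = \<sigma> (repeat_mset Q m)" "coset_sum M (repeat_mset Q m) \<approx> {#}"
        by (auto simp: W_def)
      \<comment> \<open>On an \<open>M\<close>-invariant element the coset sum is multiplication by
        \<open>card M\<close>, which is coprime to \<open>q ^ k\<close>.\<close>
      have "image_mset (\<lambda>x. x + b) (repeat_mset Q m) \<approx> repeat_mset Q m" if "b \<in> M" for b
        using hD[of "- b"] that sub by (simp add: m(1) \<Delta>_\<sigma> eqv_def subgrp_def)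
      then have "coset_sum M (repeat_mset Q m) \<approx> repeat_mset (card M) (repeat_mset Q m)"
        unfolding coset_sum_def by (intro sum_eqv_const) auto
      then have "repeat_mset (card M) (repeat_mset Q m) \<approx> {#}"
        using m(2) eqv_trans eqv_sym by blast
      moreover have "repeat_mset (q ^ k) (repeat_mset Q m) \<approx> {#}"
        using tors by simp
      moreover have "coprime (card M) (q ^ k)"
        using False q by (simp add: prime_imp_coprime coprime_commute)
      ultimately have "repeat_mset Q m \<approx> {#}"
        by (rule repeat_coprime_eqv)
      then show "h = id"
        by (simp add: m(1) eqv_def \<sigma>_empty)
    qed
    \<comment> \<open>\<open>Q\<close> copies of \<open>w\<close> represent \<open>Q\<close> times 0
      minus \<open>Q\<close> times \<open>c\<close>, since \<open>q ^ k * Q\<close> copies of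
      \<open>c\<close> vanish. As \<open>c\<close> is in \<open>M\<close>, the points
      \<open>c\<close> and 0 have the same coset sum, which puts this element into the trivial group
      \<open>W\<close>.\<close>
    define w where "w = {#0#} + repeat_mset (q ^ k - 1) {#c#}"
    have qk: "q ^ k = Suc (q ^ k - 1)"
      using q by (simp add: prime_gt_0_nat)
    have "coset_sum M {#c#} = coset_sum M {#0#}"
    proof -
      have "bij_betw (\<lambda>b. c + b) M M"
        by (rule bij_betwI[where g = "\<lambda>b. - c + b"]) (use M sub in \<open>auto simp: subgrp_def simp del: uminus_add_conv_diff\<close>)
      then show ?thesis
        using sum.reindex_bij_betw[of "\<lambda>b. c + b" M M "\<lambda>b. {#b#}"] by (simp add: coset_sum_def)
    qed
    then have "coset_sum M w = repeat_mset (q ^ k) (coset_sum M {#0#})"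
      by (subst qk) (simp only: w_def coset_sum_union coset_sum_repeat repeat_mset_Suc)
    then have "coset_sum M (repeat_mset Q w) \<approx> {#}"
      using tors[of "coset_sum M {#0#}"] by (simp add: coset_sum_repeat mult.commute)
    then have "\<sigma> (repeat_mset Q w) \<in> W"
      by (auto simp: W_def)
    then have "repeat_mset Q w \<approx> {#}"
      using \<open>W = {id}\<close> by (simp add: eqv_def \<sigma>_empty)
    from eqv_add[OF this eqv_refl, of "repeat_mset Q {#c#}"]
    have "repeat_mset Q (w + {#c#}) \<approx> repeat_mset Q {#c#}"
      by (simp only: repeat_mset_distrib2 add_0)
    moreover have "repeat_mset Q (w + {#c#}) = repeat_mset Q {#0#} + repeat_mset (q ^ k * Q) {#c#}"
    proof -
      have "w + {#c#} = {#0#} + repeat_mset (q ^ k) {#c#}"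
        unfolding w_def by (subst (2) qk) (simp only: repeat_mset_Suc ac_simps)
      then show ?thesis
        by (simp only: repeat_mset_distrib2 repeat_mset_right mult.commute)
    qed
    moreover have "repeat_mset Q {#0#} + repeat_mset (q ^ k * Q) {#c#} \<approx> repeat_mset Q {#0#}"
      using eqv_add[OF eqv_refl tors, of "repeat_mset Q {#0#}" "{#c#}"] by (simp only: add_0_right)
    ultimately have "c \<in> K Q"
      by (simp add: K_def eqv_def)
    then show ?thesis
      using M by auto
  qed
qed

section \<open>Descent through the prime powers of the exponent\<close>

text \<open>With \<open>n = q ^ k * n'\<close>, induction gives a nonzero element of the invariant
  subgroup \<open>K (q ^ k * f)\<close>; this subgroup then meets \<open>K (n' * f)\<close>
  nontrivially, and the gcd of the two indices is \<open>f\<close>.\<close>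

lemma K_nontrivial:
  assumes "n * f = exponent" and nt: "(a::'a) \<noteq> 0"
  shows "\<exists>b\<in>K f. b \<noteq> 0"
  using assms(1)
proof (induction n arbitrary: f rule: less_induct)
  case (less n)
  have pos: "n > 0" "f > 0"
    using less.prems exponent_pos by (auto intro!: Nat.gr0I)
  show ?case
  proof (cases "n = 1")
    case True
    \<comment> \<open>Here \<open>f\<close> equals \<open>exponent\<close>, so \<open>f\<close>
      copies of any point vanish.\<close>
    then have "a \<in> K f"
      using less.prems repeat_exponent[of "{#a#}"] repeat_exponent[of "{#0#}"]
      by (simp add: K_def eqv_def)
    then show ?thesis
      using nt by auto
  next
    case False
    then obtain q where q: "prime q" "q dvd n"
      using prime_factor_nat by blast
    obtain n' where n': "n = q ^ multiplicity q n * n'" "\<not> q dvd n'"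
      by (rule multiplicity_decompose'[of n q]) (use pos q prime_gt_1_nat[of q] in auto)
    define k where "k = multiplicity q n"
    have n: "n = q ^ k * n'"
      using n' by (simp add: k_def)
    have "k > 0"
      using n' q n by (cases k) auto
    then have "n' < n"
      using n pos one_less_power[OF prime_gt_1_nat[OF q(1)]] by simp
    then obtain c where c: "c \<in> K (q ^ k * f)" "c \<noteq> 0"
      using less.IH[of n' "q ^ k * f"] less.prems n by (auto simp: mult_ac)
    have tors: "repeat_mset (q ^ k * (n' * f)) m \<approx> {#}" for m
      using repeat_exponent[of m] less.prems n by (simp add: mult_ac)
    obtain b where b: "b \<in> K (q ^ k * f)" "b \<noteq> 0" "b \<in> K (n' * f)"
      using invariant_meets_K[OF invariant_K c q(1) tors] by blast
    have "coprime (q ^ k) n'"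
      using n'(2) q(1) by (simp add: prime_imp_coprime)
    then have "gcd (q ^ k * f) (n' * f) = f"
      using gcd_mult_distrib_nat[of f "q ^ k" n'] by (simp add: mult.commute)
    then show ?thesis
      using K_gcd[OF b(1,3)] b(2) pos q by (auto simp: prime_gt_0_nat)
  qed
qed

end

theorem theorem6p2:
  fixes \<tau> :: "'a::{ab_group_add,finite} \<Rightarrow> 'a"
  assumes "quasilinear_cycle_set \<tau>"
    and "card (UNIV :: 'a set) > 1"
  shows "\<exists>b\<in>socle \<tau>. b \<noteq> 0"
proof -
  interpret quasilinear \<tau>
    using assms(1) by unfold_locales
  have "\<exists>a::'a. a \<noteq> 0"
  proof (rule ccontr)
    assume "\<not> ?thesis"
    then have "(UNIV :: 'a set) = {0}" by auto
    from arg_cong[OF this, of card] show False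
      using assms(2) by simp
  qed
  then obtain a :: 'a where "a \<noteq> 0" by blast
  then obtain b where "b \<in> K 1" "b \<noteq> 0"
    using K_nontrivial[of exponent 1 a] by auto
  then show ?thesis
    using K_1_socle[of b] by (intro bexI[of _ "- b"]) auto
qed

end
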